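(* Let $q$ be a prime power, let $n\ge 2$ be an integer, and let $\Gamma$ be the singular difference graph of $M_n(\mathbb{F}_q)$. Then $\omega(\Gamma)=q^{n^2-n}$.
   Context: $\mathbb{F}_q$ is the finite field with $q$ elements and $M_n(\mathbb{F}_q)$ is the vector space of all $n\times n$ matrices over $\mathbb{F}_q$. The singular difference graph $\Gamma$ of $M_n(\mathbb{F}_q)$ is the simple graph with vertex set $M_n(\mathbb{F}_q)$ in which two distinct matrices $A,B$ are adjacent if and only if $\det(A-B)=0$. The clique number $\omega(\Gamma)$ is the maximum cardinality of a clique of $\Gamma$, i.e. of a set of vertices in which every pair of distinct vertices is adjacent. *)

theory Defs
  imports
    "Jordan_Normal_Form.Determinant"
    "Graph_Theory.Pair_Digraph"
    "HOL-Number_Theory.Prime_Powers"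
    "HOL-Library.Cardinality"
begin

text \<open>
  A simple graph is a \<^locale>\<open>pair_graph\<close>: an undirected edge between \<open>u\<close> and \<open>v\<close> is
  the pair of arcs \<open>(u, v)\<close> and \<open>(v, u)\<close>.
\<close>

definition clique :: "'v pair_pre_digraph \<Rightarrow> 'v set \<Rightarrow> bool" where
  "clique G K \<longleftrightarrow> K \<subseteq> pverts G \<and> (\<forall>u\<in>K. \<forall>v\<in>K. u \<noteq> v \<longrightarrow> (u, v) \<in> parcs G)"

text \<open>Meaningful for finite graphs only, since \<^const>\<open>Max\<close> is unspecified on infinite sets.\<close>

definition clique_number :: "'v pair_pre_digraph \<Rightarrow> nat" where
  "clique_number G = Max {card K | K. clique G K}"

definition singular_difference_graph :: "nat \<Rightarrow> 'a :: field mat pair_pre_digraph" where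
  "singular_difference_graph n =
     \<lparr> pverts = carrier_mat n n,
       parcs = {(A, B). A \<in> carrier_mat n n \<and> B \<in> carrier_mat n n \<and> A \<noteq> B \<and> det (A - B) = 0} \<rparr>"

lemma finite_carrier_mat_finite_type:
  "finite (carrier_mat n m :: 'a :: finite mat set)"
proof -
  let ?F = "({0..<n} \<times> {0..<m}) \<rightarrow>\<^sub>E (UNIV :: 'a set)"
  have "finite ?F"
    by (intro finite_PiE) auto
  moreover have "carrier_mat n m \<subseteq> (\<lambda>f. mat n m f) ` ?F"
  proof
    fix A :: "'a mat" assume A: "A \<in> carrier_mat n m"
    let ?f = "restrict (\<lambda>ij. A $$ ij) ({0..<n} \<times> {0..<m})"
    have "A = mat n m ?f"
      using A by (intro eq_matI) auto
    moreover have "?f \<in> ?F"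
      by auto
    ultimately show "A \<in> (\<lambda>f. mat n m f) ` ?F"
      by blast
  qed
  ultimately show ?thesis
    using finite_surj by blast
qed

lemma pair_graph_singular_difference_graph:
  "pair_graph (singular_difference_graph n :: 'a :: {field, finite} mat pair_pre_digraph)"
proof -
  let ?G = "singular_difference_graph n :: 'a mat pair_pre_digraph"
  have sub: "parcs ?G \<subseteq> carrier_mat n n \<times> carrier_mat n n"
    by (auto simp: singular_difference_graph_def)
  have fin: "finite (parcs ?G)"
    using sub by (rule finite_subset) (simp add: finite_carrier_mat_finite_type)
  have "(B, A) \<in> parcs ?G" if AB: "(A, B) \<in> parcs ?G" for A B
  proof -
    have c: "A \<in> carrier_mat n n" "B \<in> carrier_mat n n"
      using AB by (auto simp: singular_difference_graph_def)
    have "B - A = (- 1) \<cdot>\<^sub>m (A - B)"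
      using c by (intro eq_matI) auto
    hence "det (B - A) = (- 1) ^ n * det (A - B)"
      using c by (simp add: det_smult)
    thus ?thesis
      using AB by (auto simp: singular_difference_graph_def)
  qed
  hence "symmetric ?G"
    by (auto simp: symmetric_def intro: symI)
  thus ?thesis
    using fin by unfold_locales
      (auto simp: singular_difference_graph_def finite_carrier_mat_finite_type)
qed

end

theory Submission
  imports
    Defs
    "HOL-Algebra.Algebraic_Closure_Type"
    "HOL-Number_Theory.Residues"
begin

text \<open>
  The lower bound is easy: two matrices that agree in one row have singular difference, so the
  \<open>q ^ (n\<^sup>2 - n)\<close> matrices whose top row vanishes form a clique
  (\<open>clique_of_max_card\<close>).

  The upper bound is the clique-coclique argument for a Cayley graph on the additive group of
  matrices. Suppose \<open>S\<close> is a set of matrices in which any two distinct members have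
  invertible difference, and let \<open>K\<close> be a clique. If \<open>A + C = B + D\<close> with \<open>A, B\<close>
  in \<open>K\<close> and \<open>C, D\<close> in \<open>S\<close>, then \<open>A - B = D - C\<close> would be singular and
  invertible at once unless both sides vanish. Hence \<open>(A, C) \<mapsto> A + C\<close> is injective on
  \<open>K \<times> S\<close> and \<open>card K * card S \<le> q ^ n\<^sup>2\<close> (\<open>clique_card_le\<close>).

  It remains to find such an \<open>S\<close> with \<open>q ^ n\<close> members (\<open>spread_set_exists\<close>). The
  field with \<open>q ^ n\<close> elements is an \<open>n\<close>-dimensional vector space over the field with
  \<open>q\<close> elements; let \<open>S\<close> consist of the matrices of its multiplication maps with respect
  to a basis. The difference of two of them is multiplication by a difference of two field
  elements, which has trivial kernel unless these elements coincide. The big field is obtained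
  inside the algebraic closure as the set of roots of \<open>X ^ (q ^ n) - X\<close>
  (\<open>extension_with_basis\<close>), so no irreducible polynomial has to be exhibited.
\<close>

section \<open>The field with \<open>q ^ n\<close> elements inside the algebraic closure\<close>

text \<open>
  Counted with multiplicity, a polynomial over an algebraically closed field has as many roots as
  its degree says, and in every characteristic a repeated root is also a root of the derivative.
\<close>
lemma card_roots_eq_degree:
  fixes p :: "'b :: alg_closed_field poly"
  assumes "\<And>x. poly p x = 0 \<Longrightarrow> poly (pderiv p) x \<noteq> 0"
  shows "card {x. poly p x = 0} = Polynomial.degree p"
proof -
  have "p \<noteq> 0"
    using assms[of 0] by auto
  then obtain A where A: "size A = Polynomial.degree p"
    "p = smult (Polynomial.lead_coeff p) (\<Prod>x\<in>#A. [:- x, 1:])"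
    using alg_closed_imp_factorization by blast
  have roots: "{x. poly p x = 0} = set_mset A"
  proof -
    have "poly p x = 0 \<longleftrightarrow> x \<in># A" for x
      using \<open>p \<noteq> 0\<close>
      by (subst A(2)) (auto simp: poly_prod_mset prod_mset_zero_iff)
    thus ?thesis by blast
  qed
  have "count A x = 1" if "x \<in># A" for x
  proof (rule ccontr)
    assume "count A x \<noteq> 1"
    moreover have "count A x > 0"
      using that by simp
    ultimately have "2 \<le> count A x"
      by linarith
    then obtain C where C: "A = replicate_mset 2 x + C"
      by (metis count_le_replicate_mset_subset_eq subset_mset.le_iff_add)
    define r where "r = smult (Polynomial.lead_coeff p) (\<Prod>y\<in>#C. [:- y, 1:])"
    have r: "p = [:- x, 1:] * ([:- x, 1:] * r)"
      by (subst A(2)) (simp only: C r_def image_mset_union image_replicate_mset prod_mset.union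
        prod_mset_replicate_mset power2_eq_square mult_smult_right mult.assoc)
    have "poly p x = 0" "poly (pderiv p) x = 0"
      unfolding r pderiv_mult by simp_all
    with assms show False by blast
  qed
  hence "size A = card (set_mset A)"
    by (simp add: size_multiset_overloaded_eq)
  with A(1) roots show ?thesis by simp
qed

lemma card_eq_CHAR_power:
  assumes "primepow (CARD('a :: {field, finite}))"
  obtains k where "k > 0" "CARD('a) = CHAR('a) ^ k" "Factorial_Ring.prime CHAR('a)"
proof -
  obtain p k where pk: "Factorial_Ring.prime p" "k > 0" "CARD('a) = p ^ k"
    using assms by (auto simp: primepow_def)
  have pr: "Factorial_Ring.prime CHAR('a)"
    using finite_imp_CHAR_pos[where 'a = 'a] prime_CHAR_semidom[where 'a = 'a] by simp
  have "CHAR('a) dvd p ^ k"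
    using CHAR_dvd_CARD[where 'a = 'a] pk(3) by simp
  hence "CHAR('a) = p"
    using pr pk(1) prime_dvd_power primes_dvd_imp_eq by blast
  with pk pr that show thesis by blast
qed

text \<open>
  Fermat's little theorem, iterated: multiplication by \<open>c \<noteq> 0\<close> permutes the nonzero
  elements, so it leaves their product unchanged.
\<close>
lemma power_card_power_eq_self:
  fixes c :: "'a :: {field, finite}"
  shows "c ^ (CARD('a) ^ n) = c"
proof (induction n)
  case (Suc n)
  have "c ^ CARD('a) = c"
  proof (cases "c = 0")
    case False
    have "(\<Prod>y\<in>UNIV - {0}. c * y) = (\<Prod>y\<in>UNIV - {0}. y)"
      by (rule prod.reindex_bij_witness[of _ "\<lambda>y. y / c" "\<lambda>y. c * y"]) (use False in auto)
    hence "c ^ (CARD('a) - 1) = 1"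
      by (simp add: prod.distrib)
    thus ?thesis
      by (metis mult.right_neutral power_minus_mult zero_less_card_finite mult.commute)
  qed simp
  thus ?case
    using Suc by (simp add: power_mult)
qed simp

text \<open>
  Take \<open>F\<close> to be the fixed points of \<open>x \<mapsto> x ^ Q\<close> with \<open>Q = q ^ n\<close>. As \<open>Q\<close>
  is a power of the characteristic, this map is a ring homomorphism, which makes \<open>F\<close> closed
  under addition and multiplication; it fixes the base field, so \<open>F\<close> is a subspace. The
  derivative of \<open>X ^ Q - X\<close> is \<open>- 1\<close>, so all its roots are simple and there are \<open>Q\<close>
  of them. Counting \<open>F\<close> through coordinates gives \<open>q ^ d\<close> elements in dimension
  \<open>d\<close>, whence \<open>d = n\<close>. The basis is presented as a family indexed by
  \<open>{..<n}\<close> so that coordinates can serve directly as matrix entries.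
\<close>
lemma extension_with_basis:
  assumes "primepow (CARD('a))" and "n > 0"
  obtains F :: "'a :: {field, finite} alg_closure set" and w :: "nat \<Rightarrow> 'a alg_closure"
  where "card F = CARD('a) ^ n"
    and "\<And>x y. x \<in> F \<Longrightarrow> y \<in> F \<Longrightarrow> x * y \<in> F"
    and "\<And>i. i < n \<Longrightarrow> w i \<in> F"
    and "\<And>x. x \<in> F \<Longrightarrow> \<exists>c. x = (\<Sum>i<n. to_ac (c i) * w i)"
    and "\<And>c i. (\<Sum>i<n. to_ac (c i) * w i) = 0 \<Longrightarrow> i < n \<Longrightarrow> c i = 0"
proof -
  define Q where "Q = CARD('a) ^ n"
  obtain k where k: "k > 0" "CARD('a) = CHAR('a) ^ k" "Factorial_Ring.prime CHAR('a)"
    using card_eq_CHAR_power[OF assms(1)] .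
  have Q_CHAR: "Q = CHAR('a alg_closure) ^ (k * n)"
    by (simp add: Q_def k(2) power_mult)
  have card_gt_1: "CARD('a) > 1"
    using assms(1) by (simp add: primepow_gt_Suc_0)
  have "Q > 1"
    using card_gt_1 assms(2) by (simp only: Q_def one_less_power)
  define F where "F = {x :: 'a alg_closure. x ^ Q = x}"

  have card_F: "card F = Q"
  proof -
    define p :: "'a alg_closure poly" where "p = Polynomial.monom 1 Q - Polynomial.monom 1 1"
    have "(of_nat Q :: 'a alg_closure) = 0"
      using k(1) assms(2) unfolding Q_CHAR of_nat_eq_0_iff_char_dvd by simp
    hence "poly (pderiv p) x = - 1" for x
      by (simp add: p_def pderiv_diff pderiv_monom poly_monom)
    hence "card {x. poly p x = 0} = Polynomial.degree p"
      by (intro card_roots_eq_degree) simp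
    moreover have "{x. poly p x = 0} = F"
      by (simp add: p_def F_def poly_monom)
    moreover have "Polynomial.degree p = Q"
    proof -
      have "Polynomial.degree (Polynomial.monom 1 1 :: 'a alg_closure poly)
          < Polynomial.degree (Polynomial.monom 1 Q :: 'a alg_closure poly)"
        using \<open>Q > 1\<close> by (simp add: degree_monom_eq)
      thus ?thesis
        unfolding p_def diff_conv_add_uminus
        by (subst degree_add_eq_left) (simp_all add: degree_monom_eq)
    qed
    ultimately show ?thesis by simp
  qed
  hence fin_F: "finite F"
    using \<open>Q > 1\<close> card.infinite by fastforce
  have F_mult: "x * y \<in> F" if "x \<in> F" "y \<in> F" for x y
    using that by (simp add: F_def power_mult_distrib)
  have F_add: "x + y \<in> F" if "x \<in> F" "y \<in> F" for x y
    using that k(3) freshmans_dream'[OF _ Q_CHAR, of x y] by (simp add: F_def)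
  have F_base: "to_ac c \<in> F" for c
    using power_card_power_eq_self[of c n] by (simp add: F_def Q_def flip: to_ac_power)

  interpret V: vector_space "\<lambda>(c :: 'a) (x :: 'a alg_closure). to_ac c * x"
    by unfold_locales (simp_all add: algebra_simps)
  have sub_F: "V.subspace F"
    using F_base[of 0] by (auto simp: V.subspace_def F_add F_mult F_base)
  obtain B where B: "B \<subseteq> F" "V.independent B" "F \<subseteq> V.span B"
    by (rule V.basis_exists[of F])
  have fin_B: "finite B"
    using B(1) fin_F finite_subset by blast
  have span_B: "V.span B = F"
    using V.span_minimal[OF B(1) sub_F] B(3) by (rule subset_antisym)
  define \<phi> where "\<phi> c = (\<Sum>b\<in>B. to_ac (c b) * b)" for c
  have \<phi>_0: "c b = 0" if "\<phi> c = 0" "b \<in> B" for c b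
    using that B(2) fin_B by (auto simp: \<phi>_def V.dependent_finite)
  have F_eq: "F = range \<phi>"
    using V.span_finite[OF fin_B] by (simp add: span_B \<phi>_def[abs_def])
  have "bij_betw \<phi> (B \<rightarrow>\<^sub>E UNIV) F"
  proof (rule bij_betw_imageI)
    show "inj_on \<phi> (B \<rightarrow>\<^sub>E UNIV)"
    proof (rule inj_onI)
      fix c d assume cd: "c \<in> B \<rightarrow>\<^sub>E UNIV" "d \<in> B \<rightarrow>\<^sub>E UNIV" "\<phi> c = \<phi> d"
      have "\<phi> (\<lambda>b. c b - d b) = 0"
        using cd(3) by (simp add: \<phi>_def algebra_simps sum_subtractf)
      hence "c b = d b" if "b \<in> B" for b
        using \<phi>_0[OF _ that] by fastforce
      thus "c = d"
        using cd by (intro PiE_ext) auto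
    qed
    have "\<phi> c \<in> \<phi> ` (B \<rightarrow>\<^sub>E UNIV)" for c
      by (intro image_eqI[of _ _ "restrict c B"]) (auto simp: \<phi>_def)
    thus "\<phi> ` (B \<rightarrow>\<^sub>E UNIV) = F"
      using F_eq by blast
  qed
  hence "card F = CARD('a) ^ card B"
    using bij_betw_same_card[of \<phi> "B \<rightarrow>\<^sub>E UNIV" F] fin_B by (simp add: card_funcsetE)
  hence "card B = n"
    using card_F card_gt_1 by (simp add: Q_def)
  then obtain w where w: "bij_betw w {..<n} B"
    using ex_bij_betw_nat_finite[OF fin_B] by (auto simp: atLeast0LessThan)
  have sum_w: "(\<Sum>i<n. to_ac (c i) * w i) = \<phi> (\<lambda>b. c (inv_into {..<n} w b))" for c
    unfolding \<phi>_def
    using bij_betw_inv_into_left[OF w]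
    by (subst sum.reindex_bij_betw[OF w, symmetric]) (auto intro!: sum.cong)
  show thesis
  proof (rule that[of F w])
    show "card F = CARD('a) ^ n"
      using card_F Q_def by simp
    show "w i \<in> F" if "i < n" for i
      using w B(1) that by (auto simp: bij_betw_def)
    show "\<exists>c. x = (\<Sum>i<n. to_ac (c i) * w i)" if x: "x \<in> F" for x
    proof -
      obtain c where "x = \<phi> c"
        using x F_eq by blast
      hence "x = (\<Sum>i<n. to_ac (c (w i)) * w i)"
        using sum.reindex_bij_betw[OF w, of "\<lambda>b. to_ac (c b) * b"] by (simp add: \<phi>_def)
      thus ?thesis
        by (rule exI[of _ "\<lambda>i. c (w i)"])
    qed
    show "c i = 0" if "(\<Sum>i<n. to_ac (c i) * w i) = 0" "i < n" for c i
      using \<phi>_0[of "\<lambda>b. c (inv_into {..<n} w b)" "w i"] that sum_w w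
        bij_betw_inv_into_left[OF w, of i] by (auto simp: bij_betw_def)
  qed (rule F_mult)
qed

section \<open>Matrices with invertible differences\<close>

text \<open>
  The matrix \<open>M a\<close> represents multiplication by \<open>a\<close> on \<open>F\<close> in the basis
  \<open>w\<close>. A kernel vector \<open>v\<close> of \<open>M a - M b\<close> is the coordinate vector of an element
  \<open>x \<noteq> 0\<close> with \<open>(a - b) * x = 0\<close>, which forces \<open>a = b\<close>.
\<close>
lemma spread_set_exists:
  assumes "primepow (CARD('a))" and "n > 0"
  obtains S :: "'a :: {field, finite} mat set"
  where "S \<subseteq> carrier_mat n n" "card S = CARD('a) ^ n"
    "\<And>A B. A \<in> S \<Longrightarrow> B \<in> S \<Longrightarrow> det (A - B) = 0 \<Longrightarrow> A = B"
proof -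
  obtain F :: "'a alg_closure set" and w where
    card_F: "card F = CARD('a) ^ n"
    and F_mult: "\<And>x y. x \<in> F \<Longrightarrow> y \<in> F \<Longrightarrow> x * y \<in> F"
    and w_F: "\<And>i. i < n \<Longrightarrow> w i \<in> F"
    and gen: "\<And>x. x \<in> F \<Longrightarrow> \<exists>c. x = (\<Sum>i<n. to_ac (c i) * w i)"
    and indep: "\<And>c i. (\<Sum>i<n. to_ac (c i) * w i) = 0 \<Longrightarrow> i < n \<Longrightarrow> c i = 0"
    using extension_with_basis[OF assms] by blast
  obtain coord where coord: "\<And>x. x \<in> F \<Longrightarrow> x = (\<Sum>i<n. to_ac (coord x i) * w i)"
    using gen by metis
  define M where "M a = mat n n (\<lambda>(i, j). coord (a * w j) i)" for a
  have M_carrier: "M a \<in> carrier_mat n n" for a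
    by (simp add: M_def)
  have M_eqD: "a = b" if ab: "a \<in> F" "b \<in> F" and det0: "det (M a - M b) = 0" for a b
  proof -
    obtain v where v: "v \<in> carrier_vec n" "v \<noteq> 0\<^sub>v n" "(M a - M b) *\<^sub>v v = 0\<^sub>v n"
      using det0 det_0_iff_vec_prod_zero_field[of "M a - M b" n] M_carrier
      by (meson minus_carrier_mat)
    \<comment> \<open>The kernel equation, read off in row \<open>i\<close>; \<open>col\<close> below says that column \<open>j\<close>
      of \<open>M a - M b\<close> holds the coordinates of \<open>(a - b) * w j\<close>.\<close>
    have row: "(\<Sum>j<n. (coord (a * w j) i - coord (b * w j) i) * v $ j) = 0" if "i < n" for i
    proof -
      have "0 = ((M a - M b) *\<^sub>v v) $ i"
        using v(3) that by simp
      also have "\<dots> = (\<Sum>j<n. (coord (a * w j) i - coord (b * w j) i) * v $ j)"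
        using v(1) that by (simp add: M_def scalar_prod_def atLeast0LessThan)
      finally show ?thesis by simp
    qed
    have col: "(a - b) * w j = (\<Sum>i<n. to_ac (coord (a * w j) i - coord (b * w j) i) * w i)"
      if "j < n" for j
      using coord[OF F_mult[OF ab(1) w_F[OF that]]] coord[OF F_mult[OF ab(2) w_F[OF that]]]
      by (simp add: left_diff_distrib sum_subtractf)
    have "(a - b) * (\<Sum>j<n. to_ac (v $ j) * w j) = (\<Sum>j<n. to_ac (v $ j) * ((a - b) * w j))"
      by (simp add: sum_distrib_left mult_ac)
    also have "\<dots> = (\<Sum>j<n. \<Sum>i<n.
        to_ac ((coord (a * w j) i - coord (b * w j) i) * v $ j) * w i)"
      by (intro sum.cong refl, subst col) (simp_all add: sum_distrib_left mult_ac)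
    also have "\<dots> = (\<Sum>i<n. \<Sum>j<n.
        to_ac ((coord (a * w j) i - coord (b * w j) i) * v $ j) * w i)"
      by (rule sum.swap)
    also have "\<dots> = (\<Sum>i<n. to_ac (\<Sum>j<n.
        (coord (a * w j) i - coord (b * w j) i) * v $ j) * w i)"
      by (simp add: to_ac_sum sum_distrib_right del: to_ac_mult to_ac_diff)
    also have "\<dots> = 0"
      by (simp add: row del: to_ac_mult to_ac_diff)
    finally have "a = b \<or> (\<Sum>j<n. to_ac (v $ j) * w j) = 0"
      by simp
    moreover have "(\<Sum>j<n. to_ac (v $ j) * w j) \<noteq> 0"
      using indep[of "($) v"] v(1,2) by (auto intro!: eq_vecI)
    ultimately show ?thesis by blast
  qed
  have "inj_on M F"
  proof (rule inj_onI)
    fix a b assume "a \<in> F" "b \<in> F" "M a = M b"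
    moreover have "det (0\<^sub>m n n :: 'a mat) = 0"
      using assms(2) by (simp add: det_zero)
    ultimately show "a = b"
      using M_eqD[of a b] minus_r_inv_mat[OF M_carrier[of b]] by simp
  qed
  show thesis
  proof (rule that[of "M ` F"])
    show "card (M ` F) = CARD('a) ^ n"
      using card_image[OF \<open>inj_on M F\<close>] card_F by simp
    show "M ` F \<subseteq> carrier_mat n n"
      using M_carrier by blast
    show "A = B" if "A \<in> M ` F" "B \<in> M ` F" "det (A - B) = 0" for A B
      using that M_eqD by blast
  qed
qed

section \<open>Bounds on cliques\<close>

lemma card_carrier_mat:
  "card (carrier_mat m n :: 'a :: finite mat set) = CARD('a) ^ (m * n)"
proof -
  let ?I = "{..<m} \<times> {..<n}"
  have "bij_betw (\<lambda>f. mat m n f) (?I \<rightarrow>\<^sub>E (UNIV :: 'a set)) (carrier_mat m n)"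
  proof (rule bij_betwI[where g = "\<lambda>A. restrict (($$) A) ?I"])
    show "restrict (($$) (mat m n f)) ?I = f" if "f \<in> ?I \<rightarrow>\<^sub>E UNIV" for f :: "nat \<times> nat \<Rightarrow> 'a"
      using that by (intro PiE_ext[of _ ?I "\<lambda>_. UNIV"]) auto
  qed (auto intro!: eq_matI)
  thus ?thesis
    using bij_betw_same_card[of _ "?I \<rightarrow>\<^sub>E (UNIV :: 'a set)"] by (fastforce simp: card_funcsetE)
qed

lemma clique_card_le:
  fixes K :: "'a :: {field, finite} mat set"
  assumes "primepow (CARD('a))" "n > 0" and K: "clique (singular_difference_graph n) K"
  shows "card K \<le> CARD('a) ^ (n\<^sup>2 - n)"
proof -
  obtain S :: "'a mat set" where S: "S \<subseteq> carrier_mat n n" "card S = CARD('a) ^ n"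
    "\<And>A B. A \<in> S \<Longrightarrow> B \<in> S \<Longrightarrow> det (A - B) = 0 \<Longrightarrow> A = B"
    using spread_set_exists[OF assms(1,2)] by blast
  have K_carrier: "K \<subseteq> carrier_mat n n"
    and K_det: "\<And>A B. A \<in> K \<Longrightarrow> B \<in> K \<Longrightarrow> A \<noteq> B \<Longrightarrow> det (A - B) = 0"
    using K by (auto simp: clique_def singular_difference_graph_def)
  have "inj_on (\<lambda>(A, C). A + C) (K \<times> S)"
  proof (rule inj_onI, clarify)
    fix A C B D
    assume *: "A \<in> K" "C \<in> S" "B \<in> K" "D \<in> S" "A + C = B + D"
    have carr: "A \<in> carrier_mat n n" "B \<in> carrier_mat n n" "C \<in> carrier_mat n n" "D \<in> carrier_mat n n"
      using * K_carrier S(1) by auto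
    have entry: "A $$ (i, j) + C $$ (i, j) = B $$ (i, j) + D $$ (i, j)" if "i < n" "j < n" for i j
      using *(5) that carr by (metis carrier_matD index_add_mat(1))
    have diff: "A - B = D - C"
      using carr entry by (intro eq_matI) (auto simp: algebra_simps)
    show "A = B \<and> C = D"
    proof (cases "A = B")
      case True
      have "C = D"
        using carr entry True by (intro eq_matI) auto
      with True show ?thesis by simp
    next
      case False
      hence "D = C"
        using S(3)[of D C] K_det[of A B] * diff by simp
      hence "A = B"
        using carr entry by (intro eq_matI) auto
      with False show ?thesis by simp
    qed
  qed
  moreover have "(\<lambda>(A, C). A + C) ` (K \<times> S) \<subseteq> carrier_mat n n"
    using K_carrier S(1) by auto
  ultimately have "card (K \<times> S) \<le> card (carrier_mat n n :: 'a mat set)"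
    using card_inj_on_le finite_carrier_mat_finite_type by blast
  hence "card K * CARD('a) ^ n \<le> CARD('a) ^ (n * n)"
    by (simp add: card_cartesian_product S(2) card_carrier_mat)
  also have "n * n = (n\<^sup>2 - n) + n"
    using assms(2) by (simp add: power2_eq_square)
  finally show ?thesis
    by (simp add: power_add)
qed

lemma clique_of_max_card:
  assumes "n > 0"
  obtains K :: "'a :: {field, finite} mat set"
  where "clique (singular_difference_graph n) K" "card K = CARD('a) ^ (n\<^sup>2 - n)"
proof -
  \<comment> \<open>Put a zero row on top of a matrix with \<open>n - 1\<close> rows; the truncated \<open>i - 1\<close> is only
    reached for \<open>i > 0\<close>.\<close>
  define ext :: "'a mat \<Rightarrow> 'a mat" where
    "ext A = mat n n (\<lambda>(i, j). if i = 0 then 0 else A $$ (i - 1, j))" for A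
  have inj: "inj_on ext (carrier_mat (n - 1) n)"
  proof (rule inj_onI)
    fix A B :: "'a mat"
    assume AB: "A \<in> carrier_mat (n - 1) n" "B \<in> carrier_mat (n - 1) n" "ext A = ext B"
    have "A $$ (i, j) = B $$ (i, j)" if "i < n - 1" "j < n" for i j
    proof -
      have "ext A $$ (Suc i, j) = ext B $$ (Suc i, j)"
        using AB(3) by simp
      with that show ?thesis by (simp add: ext_def)
    qed
    thus "A = B"
      using AB by (intro eq_matI) auto
  qed
  have det0: "det (ext A - ext B) = 0" for A B
  proof -
    have "det (ext A - ext B) = (\<Sum>j<n. (ext A - ext B) $$ (0, j) * cofactor (ext A - ext B) 0 j)"
      using assms by (intro laplace_expansion_row minus_carrier_mat) (simp_all add: ext_def)
    also have "\<dots> = 0"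
      using assms by (intro sum.neutral) (simp add: ext_def)
    finally show ?thesis .
  qed
  show thesis
  proof (rule that[of "ext ` carrier_mat (n - 1) n"])
    show "clique (singular_difference_graph n) (ext ` carrier_mat (n - 1) n)"
      by (auto simp: clique_def singular_difference_graph_def det0) (simp_all add: ext_def)
    have "(n - 1) * n = n\<^sup>2 - n"
      by (simp add: power2_eq_square diff_mult_distrib)
    thus "card (ext ` carrier_mat (n - 1) n) = CARD('a) ^ (n\<^sup>2 - n)"
      by (simp only: card_image[OF inj] card_carrier_mat)
  qed
qed

theorem theorem4p12:
  fixes \<Gamma> :: "'a :: {field, finite} mat pair_pre_digraph"
    and q n :: nat
  assumes "primepow q"
    and "CARD('a) = q"
    and "n \<ge> 2"
    and "\<Gamma> = singular_difference_graph n"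
  shows "clique_number \<Gamma> = q ^ (n\<^sup>2 - n)"
proof -
  have n: "n > 0"
    using assms(3) by simp
  have le: "card K \<le> q ^ (n\<^sup>2 - n)" if "clique \<Gamma> K" for K
    using clique_card_le[of n K] assms n that by simp
  obtain K :: "'a mat set" where K: "clique \<Gamma> K" "card K = q ^ (n\<^sup>2 - n)"
    using clique_of_max_card[OF n, where 'a = 'a] assms by metis
  show ?thesis
    unfolding clique_number_def
  proof (rule Max_eqI)
    show "finite {card K |K. clique \<Gamma> K}"
      by (rule finite_subset[of _ "{..q ^ (n\<^sup>2 - n)}"]) (auto intro: le)
    show "q ^ (n\<^sup>2 - n) \<in> {card K |K. clique \<Gamma> K}"
      unfolding K(2)[symmetric] using K(1) by blast
  qed (auto intro: le)
qed

end
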